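(* Let $\mathbf c^*$ be an optimal solution of $$\min_{\mathbf c\in\mathbb R^{|\mathcal E|}}\ \sum_{e\in\mathcal E}\Psi_e(c_e;Q_{e,\epsilon})\quad\text{s.t.}\quad\mathbf I\mathbf c=\mathbf I^+\mathbf s,$$ and let $\mathbf\Lambda^*\in\mathbb R^{|\mathcal V|}$ be the corresponding Lagrangian multiplier of the constraint. Then $\mathbf c^*$ and $\mathbf\Lambda^*$ must satisfy $$\mathbf c^*=\mathbf Q(\mathbf\Lambda^* )\quad\text{and}\quad 0=\mathbf I\,\mathbf Q(\mathbf\Lambda^* )-\mathbf I^+\mathbf s,$$ where $\mathbf Q(\mathbf\Lambda)=\left(Q_{e,\epsilon}\!\left(\frac{l_e-(\mathbf I^{\mathrm T}\mathbf\Lambda)_e}{2}\right)\right)_{e\in\mathcal E}$.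
   Context: $(\mathcal V,\mathcal E)$ is an undirected network. Each edge $e\in\mathcal E$ has length $l_e\ge 0$ and end nodes $v_e^-,v_e^+\in\mathcal V$ (an arbitrary orientation from $v_e^-$ to $v_e^+$ is fixed). A location on $e$ is recorded as $(e,x)$, $x\in[0,l_e]$, where $x$ is the distance from $v_e^-$ along $e$. Put $\mathcal L_e(x)=\{(e,y):y\in[0,x]\}$ and $\mathcal L=\bigcup_{e}\mathcal L_e(l_e)$. $U,V\subset\mathcal L$ are finite sets of supply and demand points with $|U|=|V|=n$. The imbalance profile of edge $e$ is $S_e(x)=|U\cap\mathcal L_e(x)|-|V\cap\mathcal L_e(x)|$ for $x\in[0,l_e]$, and $\mathbf s=(S_e(l_e))_{e\in\mathcal E}$. For a profile $\xi_e:[0,l_e]\to\mathbb R$ and $c\in\mathbb R$: $\Psi_e(c;\xi_e)=\int_0^{l_e}|\xi_e(x)-c|\,dx$; $F_e(c;\xi_e)$ is the Lebesgue measure of $\{x\in[0,l_e]:\xi_e(x)\le c\}$; and $Q_e(t;\xi_e)=\inf\{c:F_e(c;\xi_e)\ge t\}$. $\mathbf I^+$ (resp. $\mathbf I^-$) is the $\mathcal V\times\mathcal E$ matrix whose $(v,e)$ entry is $1$ if $v_e^+=v$ (resp. $v_e^-=v$) and $0$ otherwise; $\mathbf I=\mathbf I^+-\mathbf I^-$. For a smoothing parameter $\epsilon>0$, $Q_{e,\epsilon}$ is an approximation of $Q_e(\cdot;S_e)$ with $Q_{e,\epsilon}\in C^2([0,l_e])$, $Q_{e,\epsilon}'>0$,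 and $\max_e\|Q_{e,\epsilon}-Q_e(\cdot;S_e)\|_{L^1(0,l_e)}\to0$ as $\epsilon\downarrow0$. The Lagrangian sign convention is that the multiplier satisfies $0\in\partial\Psi_e(c_e^*;Q_{e,\epsilon})+(\mathbf I^{\mathrm T}\mathbf\Lambda^* )_e$ for all $e\in\mathcal E$, where $\partial$ is the subdifferential in the first argument.
   Formalization: The formal statement adds the hypothesis that each c*_e lies in the range Q_{e,ε}([0,l_e]); without it the claim fails (the constraint may force c*_e outside this range), and the conclusion itself implies it. *)

theory Defs
  imports "HOL-Analysis.Analysis"
begin

text \<open>
  A network is given by finite types \<open>'v\<close> of nodes and \<open>'e\<close> of edges, edge lengths
  \<open>l :: 'e \<Rightarrow> real\<close> and the two end-node maps \<open>v\<^sub>m, v\<^sub>p :: 'e \<Rightarrow> 'v\<close> (the ends with superscript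
  minus and plus). Parallel edges and loops are allowed. A location is a pair \<open>(e, x)\<close>, where \<open>x\<close>
  is the distance from \<open>v\<^sub>m e\<close> along \<open>e\<close>.
\<close>

definition edge_part :: "'e \<Rightarrow> real \<Rightarrow> ('e \<times> real) set" where
  "edge_part e x = {(e, y) | y. y \<in> {0..x}}"

definition locations :: "('e \<Rightarrow> real) \<Rightarrow> ('e \<times> real) set" where
  "locations l = (\<Union>e. edge_part e (l e))"

definition imbalance :: "('e \<times> real) set \<Rightarrow> ('e \<times> real) set \<Rightarrow> 'e \<Rightarrow> real \<Rightarrow> real" where
  "imbalance U V e x = real (card (U \<inter> edge_part e x)) - real (card (V \<inter> edge_part e x))"

definition net_imbalance ::
    "('e::finite \<Rightarrow> real) \<Rightarrow> ('e \<times> real) set \<Rightarrow> ('e \<times> real) set \<Rightarrow> real ^ 'e" where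
  "net_imbalance l U V = (\<chi> e. imbalance U V e (l e))"

text \<open>
  In the next three definitions \<open>L\<close> is the length of the edge and \<open>\<xi>\<close> its profile; only the values
  of \<open>\<xi>\<close> on \<open>{0..L}\<close> matter.
\<close>

definition edge_cost :: "real \<Rightarrow> (real \<Rightarrow> real) \<Rightarrow> real \<Rightarrow> real" where
  "edge_cost L \<xi> c = integral {0..L} (\<lambda>x. \<bar>\<xi> x - c\<bar>)"

definition level_measure :: "real \<Rightarrow> (real \<Rightarrow> real) \<Rightarrow> real \<Rightarrow> real" where
  "level_measure L \<xi> c = measure lebesgue {x \<in> {0..L}. \<xi> x \<le> c}"

text \<open>
  At \<open>t = 0\<close> the set below is all of the reals, so that the mathematical value is minus infinity
  whereas \<open>Inf\<close> is an unspecified real. This is a single point and does not affect the \<open>L\<^sup>1\<close>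
  distance in \<open>smoothing\<close>.
\<close>

definition quantile :: "real \<Rightarrow> (real \<Rightarrow> real) \<Rightarrow> real \<Rightarrow> real" where
  "quantile L \<xi> t = Inf {c. level_measure L \<xi> c \<ge> t}"

definition incidence_head :: "('e::finite \<Rightarrow> 'v::finite) \<Rightarrow> real ^ 'e ^ 'v" where
  "incidence_head v\<^sub>p = (\<chi> v e. if v\<^sub>p e = v then 1 else 0)"

definition incidence_tail :: "('e::finite \<Rightarrow> 'v::finite) \<Rightarrow> real ^ 'e ^ 'v" where
  "incidence_tail v\<^sub>m = (\<chi> v e. if v\<^sub>m e = v then 1 else 0)"

definition incidence ::
    "('e::finite \<Rightarrow> 'v::finite) \<Rightarrow> ('e \<Rightarrow> 'v) \<Rightarrow> real ^ 'e ^ 'v" where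
  "incidence v\<^sub>m v\<^sub>p = incidence_head v\<^sub>p - incidence_tail v\<^sub>m"

text \<open>
  Twice continuously differentiable on the closed interval \<open>{0..L}\<close> (one-sided derivatives at the
  ends) with positive first derivative. For \<open>L = 0\<close> the condition is vacuous.
\<close>

definition smooth_increasing :: "real \<Rightarrow> (real \<Rightarrow> real) \<Rightarrow> bool" where
  "smooth_increasing L q \<longleftrightarrow>
     (\<exists>q' q''.
        (\<forall>x\<in>{0..L}. (q has_real_derivative q' x) (at x within {0..L})) \<and>
        (\<forall>x\<in>{0..L}. (q' has_real_derivative q'' x) (at x within {0..L})) \<and>
        continuous_on {0..L} q'' \<and>
        (\<forall>x\<in>{0..L}. q' x > 0))"

text \<open>\<open>Q \<epsilon> e\<close> is the smoothed quantile function of edge \<open>e\<close> for the smoothing parameter \<open>\<epsilon>\<close>.\<close>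

definition smoothing ::
    "('e::finite \<Rightarrow> real) \<Rightarrow> ('e \<times> real) set \<Rightarrow> ('e \<times> real) set
      \<Rightarrow> (real \<Rightarrow> 'e \<Rightarrow> real \<Rightarrow> real) \<Rightarrow> bool" where
  "smoothing l U V Q \<longleftrightarrow>
     (\<forall>\<epsilon>>0. \<forall>e. smooth_increasing (l e) (Q \<epsilon> e)) \<and>
     ((\<lambda>\<epsilon>. Max (range (\<lambda>e.
         integral {0..l e} (\<lambda>t. \<bar>Q \<epsilon> e t - quantile (l e) (imbalance U V e) t\<bar>))))
       \<longlongrightarrow> 0) (at_right 0)"

definition subdifferential :: "(real \<Rightarrow> real) \<Rightarrow> real \<Rightarrow> real set" where
  "subdifferential f c = {g. \<forall>y. f y \<ge> f c + g * (y - c)}"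

definition quantile_arg ::
    "('e::finite \<Rightarrow> real) \<Rightarrow> ('e \<Rightarrow> 'v::finite) \<Rightarrow> ('e \<Rightarrow> 'v) \<Rightarrow> real ^ 'v \<Rightarrow> 'e \<Rightarrow> real" where
  "quantile_arg l v\<^sub>m v\<^sub>p \<Lambda> e = (l e - (transpose (incidence v\<^sub>m v\<^sub>p) *v \<Lambda>) $ e) / 2"

text \<open>
  The subgradient condition always puts \<open>quantile_arg\<close> into \<open>{0..l e}\<close>, so \<open>c = quantile_vec \<dots>\<close>
  forces every \<open>c $ e\<close> into the range of \<open>Q \<epsilon> e\<close> on \<open>{0..l e}\<close>. An optimal \<open>c\<close> can lie outside
  this range (for instance when the constraint alone determines it), whence the range hypothesis
  of the theorem.
\<close>

definition quantile_vec ::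
    "('e::finite \<Rightarrow> real) \<Rightarrow> ('e \<Rightarrow> 'v::finite) \<Rightarrow> ('e \<Rightarrow> 'v) \<Rightarrow> ('e \<Rightarrow> real \<Rightarrow> real)
      \<Rightarrow> real ^ 'v \<Rightarrow> real ^ 'e" where
  "quantile_vec l v\<^sub>m v\<^sub>p q \<Lambda> = (\<chi> e. q e (quantile_arg l v\<^sub>m v\<^sub>p \<Lambda> e))"

end

theory Submission
  imports Defs
begin

text \<open>
  For a continuous increasing profile \<open>q\<close> on \<open>{0..L}\<close>, raising the level \<open>c = q t\<close> lengthens the
  distance to the values on \<open>{0..t}\<close> and shortens it on \<open>{t..L}\<close>, so the cost has the single
  subgradient \<open>t - (L - t) = 2 * t - L\<close> at \<open>c\<close>, also at the end points \<open>t = 0\<close> and \<open>t = L\<close>.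
  Solving \<open>2 * t - L = - a\<close>, with \<open>a\<close> the entry of the transposed incidence matrix applied to the
  multiplier, gives \<open>t = (L - a) / 2\<close> on every edge.
\<close>

lemma smooth_increasing_continuous_on:
  assumes "smooth_increasing L q"
  shows "continuous_on {0..L} q"
  using assms unfolding smooth_increasing_def
  by (metis DERIV_continuous continuous_on_eq_continuous_within)

lemma smooth_increasing_strict_mono_on:
  assumes "smooth_increasing L q"
  shows "strict_mono_on {0..L} q"
proof (rule strict_mono_onI)
  fix r s assume rs: "r \<in> {0..L}" "s \<in> {0..L}" "r < s"
  obtain q' where q': "\<And>x. x \<in> {0..L} \<Longrightarrow> (q has_real_derivative q' x) (at x within {0..L})"
    "\<And>x. x \<in> {0..L} \<Longrightarrow> q' x > 0"
    using assms unfolding smooth_increasing_def by metis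
  show "q r < q s"
  \<comment> \<open>Derivatives at \<open>0\<close> and \<open>L\<close> are only one-sided, so the
    argument uses them at interior points and takes just continuity at the ends.\<close>
  proof (rule DERIV_pos_imp_increasing_open[OF \<open>r < s\<close>])
    fix x assume x: "r < x" "x < s"
    then have "at x within {0..L} = at x"
      using rs by (intro at_within_interior) (auto simp: interior_atLeastAtMost_real)
    then show "\<exists>y. (q has_real_derivative y) (at x) \<and> 0 < y"
      using q'[of x] x rs by auto
  next
    show "continuous_on {r..s} q"
      by (rule continuous_on_subset[OF smooth_increasing_continuous_on[OF assms]]) (use rs in auto)
  qed
qed

text \<open>Integrating the pointwise bounds adds \<open>s * (y - c)\<close> on the left piece and
  subtracts \<open>(L - s) * (y - c)\<close> on the right one. The guards \<open>0 < s\<close> and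
  \<open>s < L\<close> spare a piece of length zero from any bound, which allows levels
  \<open>y\<close> outside the range of \<open>q\<close>.\<close>

lemma edge_cost_split_bound:
  assumes cont: "continuous_on {0..L} q" and s: "s \<in> {0..L}"
    and low: "\<And>x. 0 < s \<Longrightarrow> x \<in> {0..s} \<Longrightarrow> \<bar>q x - y\<bar> \<le> \<bar>q x - c\<bar> + (y - c)"
    and high: "\<And>x. s < L \<Longrightarrow> x \<in> {s..L} \<Longrightarrow> \<bar>q x - y\<bar> \<le> \<bar>q x - c\<bar> - (y - c)"
  shows "edge_cost L q y \<le> edge_cost L q c + (2 * s - L) * (y - c)"
proof -
  have int: "(\<lambda>x. \<bar>q x - a\<bar>) integrable_on {u..v}" if "0 \<le> u" "v \<le> L" for a u v
    by (intro integrable_continuous_interval continuous_intros continuous_on_subset[OF cont])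
      (use that in auto)
  have split: "edge_cost L q a
      = integral {0..s} (\<lambda>x. \<bar>q x - a\<bar>) + integral {s..L} (\<lambda>x. \<bar>q x - a\<bar>)" for a
    unfolding edge_cost_def using s int[of 0 L a]
    by (intro Henstock_Kurzweil_Integration.integral_combine[symmetric]) auto
  have "integral {0..s} (\<lambda>x. \<bar>q x - y\<bar>) \<le> integral {0..s} (\<lambda>x. \<bar>q x - c\<bar> + (y - c))"
  proof (cases "s = 0")
    case False
    with s show ?thesis
      by (intro integral_le int integrable_add integrable_const_ivl low) auto
  qed simp
  also have "\<dots> = integral {0..s} (\<lambda>x. \<bar>q x - c\<bar>) + s * (y - c)"
    using s by (subst integral_add) (auto intro: int)
  finally have A: "integral {0..s} (\<lambda>x. \<bar>q x - y\<bar>) \<le> \<dots>" .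
  have "integral {s..L} (\<lambda>x. \<bar>q x - y\<bar>) \<le> integral {s..L} (\<lambda>x. \<bar>q x - c\<bar> - (y - c))"
  proof (cases "s = L")
    case False
    with s show ?thesis
      by (intro integral_le int integrable_diff integrable_const_ivl high) auto
  qed simp
  also have "\<dots> = integral {s..L} (\<lambda>x. \<bar>q x - c\<bar>) - (L - s) * (y - c)"
    using s by (subst integral_diff) (auto intro: int)
  finally have B: "integral {s..L} (\<lambda>x. \<bar>q x - y\<bar>) \<le> \<dots>" .
  show ?thesis
    using A B unfolding split by (simp add: algebra_simps)
qed

text \<open>The secants of the cost from \<open>q t\<close> to nearby levels \<open>q s\<close>
  squeeze \<open>g\<close>: those with \<open>s > t\<close> bound it above, those with
  \<open>s < t\<close> below, and \<open>s\<close> tends to \<open>t\<close>.\<close>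

lemma subgradient_edge_cost:
  assumes cont: "continuous_on {0..L} q" and mono: "strict_mono_on {0..L} q"
    and t: "t \<in> {0..L}" and g: "g \<in> subdifferential (edge_cost L q) (q t)"
  shows "g = 2 * t - L"
proof (rule antisym)
  have le: "q u \<le> q v" if "u \<in> {0..L}" "v \<in> {0..L}" "u \<le> v" for u v
    using mono that by (simp add: strict_mono_on_leD)
  have slope: "g * (y - q t) \<le> (2 * s - L) * (y - q t)"
    if "s \<in> {0..L}"
      and "\<And>x. 0 < s \<Longrightarrow> x \<in> {0..s} \<Longrightarrow> \<bar>q x - y\<bar> \<le> \<bar>q x - q t\<bar> + (y - q t)"
      and "\<And>x. s < L \<Longrightarrow> x \<in> {s..L} \<Longrightarrow> \<bar>q x - y\<bar> \<le> \<bar>q x - q t\<bar> - (y - q t)" for s y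
  proof -
    have "edge_cost L q (q t) + g * (y - q t) \<le> edge_cost L q y"
      using g by (simp add: subdifferential_def)
    also have "\<dots> \<le> edge_cost L q (q t) + (2 * s - L) * (y - q t)"
      using that by (rule edge_cost_split_bound[OF cont])
    finally show ?thesis by simp
  qed
  show "g \<le> 2 * t - L"
  proof (cases "t = L")
    case True
    \<comment> \<open>There is no \<open>s\<close> to the right of \<open>t = L\<close>, so a level
      above all values of \<open>q\<close> serves instead; with split point \<open>L\<close> only
      the triangle inequality is required.\<close>
    have "g * (q t + 1 - q t) \<le> (2 * L - L) * (q t + 1 - q t)"
      by (rule slope) (use t in auto)
    then show ?thesis using True by simp
  next
    case False
    have "(g + L) / 2 \<le> s" if s: "t < s" "s < L" for s
    proof -
      have "q t < q s" using mono s t by (simp add: strict_mono_on_def)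
      moreover have "g * (q s - q t) \<le> (2 * s - L) * (q s - q t)"
      \<comment> \<open>On \<open>{0..s}\<close> the bound is the triangle inequality; on
        \<open>{s..L}\<close> the values of \<open>q\<close> lie above both levels, so the distances
        differ by exactly \<open>q s - q t\<close>.\<close>
      proof (rule slope)
        fix x assume "x \<in> {s..L}"
        then have "q s \<le> q x" using le s t by simp
        with \<open>q t < q s\<close> show "\<bar>q x - q s\<bar> \<le> \<bar>q x - q t\<bar> - (q s - q t)" by simp
      qed (use s t \<open>q t < q s\<close> in auto)
      ultimately show ?thesis by simp
    qed
    then have "(g + L) / 2 \<le> t"
      using False t by (intro dense_ge_bounded[of t L]) auto
    then show ?thesis by simp
  qed
  show "2 * t - L \<le> g"
  proof (cases "t = 0")
    case True
    \<comment> \<open>Mirror image at the left end: a level below all values of \<open>q\<close>,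
      with split point \<open>0\<close>.\<close>
    have "g * (q t - 1 - q t) \<le> (2 * 0 - L) * (q t - 1 - q t)"
      by (rule slope) (use t in auto)
    then show ?thesis using True by simp
  next
    case False
    have "s \<le> (g + L) / 2" if s: "0 < s" "s < t" for s
    proof -
      have "q s < q t" using mono s t by (simp add: strict_mono_on_def)
      moreover have "g * (q s - q t) \<le> (2 * s - L) * (q s - q t)"
      proof (rule slope)
        fix x assume "x \<in> {0..s}"
        then have "q x \<le> q s" using le s t by simp
        with \<open>q s < q t\<close> show "\<bar>q x - q s\<bar> \<le> \<bar>q x - q t\<bar> + (q s - q t)" by simp
      qed (use s t \<open>q s < q t\<close> in auto)
      \<comment> \<open>Here \<open>q s - q t\<close> is negative, so cancelling it reverses the
        inequality and yields \<open>2 * s - L \<le> g\<close>.\<close>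
      ultimately show ?thesis by (simp add: mult_le_cancel_right)
    qed
    then have "t \<le> (g + L) / 2"
      using False t by (intro dense_le_bounded[of 0 t]) auto
    then show ?thesis by simp
  qed
qed

theorem theorem4:
  fixes l :: "'e::finite \<Rightarrow> real"
    and v\<^sub>m v\<^sub>p :: "'e \<Rightarrow> 'v::finite"
    and U V :: "('e \<times> real) set"
    and n :: nat
    and Q :: "real \<Rightarrow> 'e \<Rightarrow> real \<Rightarrow> real"
    and \<epsilon> :: real
    and c :: "real ^ 'e"
    and \<Lambda> :: "real ^ 'v"
  assumes "\<And>e. l e \<ge> 0"
    and "U \<subseteq> locations l" "finite U" "card U = n"
    and "V \<subseteq> locations l" "finite V" "card V = n"
    and "smoothing l U V Q"
    and "\<epsilon> > 0"
    and optimal: "is_arg_min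
          (\<lambda>c :: real ^ 'e. \<Sum>e\<in>UNIV. edge_cost (l e) (Q \<epsilon> e) (c $ e))
          (\<lambda>c. incidence v\<^sub>m v\<^sub>p *v c = incidence_head v\<^sub>p *v net_imbalance l U V)
          c"
    and multiplier: "\<And>e. 0 \<in> (\<lambda>g. g + (transpose (incidence v\<^sub>m v\<^sub>p) *v \<Lambda>) $ e) `
          subdifferential (edge_cost (l e) (Q \<epsilon> e)) (c $ e)"
    and in_range: "\<And>e. c $ e \<in> Q \<epsilon> e ` {0..l e}"
  shows "(\<forall>e. quantile_arg l v\<^sub>m v\<^sub>p \<Lambda> e \<in> {0..l e}) \<and>
    c = quantile_vec l v\<^sub>m v\<^sub>p (Q \<epsilon>) \<Lambda> \<and>
    0 = incidence v\<^sub>m v\<^sub>p *v quantile_vec l v\<^sub>m v\<^sub>p (Q \<epsilon>) \<Lambda> - incidence_head v\<^sub>p *v net_imbalance l U V"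
proof -
  have edge: "quantile_arg l v\<^sub>m v\<^sub>p \<Lambda> e \<in> {0..l e} \<and> c $ e = Q \<epsilon> e (quantile_arg l v\<^sub>m v\<^sub>p \<Lambda> e)" for e
  proof -
    have smooth: "smooth_increasing (l e) (Q \<epsilon> e)"
      using \<open>smoothing l U V Q\<close> \<open>\<epsilon> > 0\<close> by (simp add: smoothing_def)
    \<comment> \<open>This preimage will turn out to be \<open>quantile_arg\<close> itself, which
      also places \<open>quantile_arg\<close> in \<open>{0..l e}\<close>.\<close>
    obtain t where t: "t \<in> {0..l e}" "c $ e = Q \<epsilon> e t"
      using in_range by blast
    obtain g where g: "g \<in> subdifferential (edge_cost (l e) (Q \<epsilon> e)) (Q \<epsilon> e t)"
      "0 = g + (transpose (incidence v\<^sub>m v\<^sub>p) *v \<Lambda>) $ e"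
      using multiplier[of e] t by auto
    have "g = 2 * t - l e"
      using smooth_increasing_continuous_on[OF smooth] smooth_increasing_strict_mono_on[OF smooth] t(1) g(1)
      by (rule subgradient_edge_cost)
    then have "(transpose (incidence v\<^sub>m v\<^sub>p) *v \<Lambda>) $ e = l e - 2 * t"
      using g(2) by simp
    then have "quantile_arg l v\<^sub>m v\<^sub>p \<Lambda> e = t"
      by (simp add: quantile_arg_def)
    with t show ?thesis by simp
  qed
  then have "c = quantile_vec l v\<^sub>m v\<^sub>p (Q \<epsilon>) \<Lambda>"
    by (simp add: quantile_vec_def vec_eq_iff)
  \<comment> \<open>The second equation is the feasibility of the minimizer, rewritten with the
    formula for \<open>c\<close>.\<close>
  moreover have "incidence v\<^sub>m v\<^sub>p *v c = incidence_head v\<^sub>p *v net_imbalance l U V"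
    using optimal by (simp add: is_arg_min_def)
  ultimately show ?thesis using edge by auto
qed

end
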